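(* Consider the minimization problem $$\min_{u\in L^2(I_{\mathrm{ctrl}})} H(u),\qquad H(u)=\int_{1/\lambda_{\min}}^{T}\mathbb E\left[\left(u\left(s-\frac1\lambda\right)-D(s)\right)^2\right]\,\mathrm ds,$$ where $\lambda$, $D$ and $m$ satisfy assumptions (A1)--(A5) listed in the context. Then, for almost every $t\in I_{\mathrm{ctrl}}$ with $q(t)>0$, the unique optimal control is $$u^*(t)=\frac{\displaystyle\int_{\Lambda(t)}m\left(t+\frac1\ell\right)\phi_\lambda(\ell)\,\mathrm d\ell}{q(t)}.$$ Equivalently, $$u^*(t)=\mathbb E\left[D\left(t+\frac1\lambda\right)\,\middle|\,t+\frac1\lambda\in I_{\mathrm{obs}}\right].$$
   Context: Let $(\Omega,\mathcal F,\mathbb P)$ be a probability space, $0<\lambda_{\min}<\lambda_{\max}$, and $T>1/\lambda_{\min}$. Assumptions: (A1) $\lambda:\Omega\to\mathbb R$ is a random variable with $\lambda_{\min}\le\lambda\le\lambda_{\max}$ almost surely. (A2) The cumulative distribution function $F_\lambda$ of $\lambda$ belongs to $C^1([\lambda_{\min},\lambda_{\max}])$, and $\lambda$ has density $\phi_\lambda$. (A3) $D:[0,T]\times\Omega\to[0,\infty)$ (the demand) is jointly measurable and $D\in L^2(\Omega\times(0,T))$. (A4) $m(t):=\mathbb E[D(t)]$ denotes the mean demand. (A5) $\lambda$ is independent of the process $D$, i.e. $\sigma(\lambda)$ and $\sigma(D(t):t\in[0,T])$ are independent. Origin of the problem: for each $\omega$, $\rho_t+\lambda(\omega)\rho_x=0$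 on $(0,1)$ with inflow $\lambda(\omega)\rho(0,t;\omega)=u(t)$; for $s\ge 1/\lambda_{\min}$ the outflow at $x=1$ is $u(s-1/\lambda(\omega))$, and $H$ is the expected squared mismatch between outflow and demand over the observation window. Notation: $I_{\mathrm{obs}}:=[1/\lambda_{\min},T]$, $I_{\mathrm{ctrl}}:=[0,T-1/\lambda_{\max}]$. For $t\in I_{\mathrm{ctrl}}$, $$\Lambda(t):=\left\{\ell\in[\lambda_{\min},\lambda_{\max}]:\frac1{\lambda_{\min}}\le t+\frac1\ell\le T\right\},\qquad q(t):=\int_{\Lambda(t)}\phi_\lambda(\ell)\,\mathrm d\ell.$$ Values of the control at points $t$ with $q(t)=0$ do not affect the objective; formulas and uniqueness are understood on the set where $q(t)>0$ (up to null sets). The conditional expectation is the elementary one given an event of positive probability.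
   Formalization: A minimizer in L^2(I_ctrl) need not exist, as u* may fail to be square integrable; proved instead: the minimizers are exactly the L^2 controls equal to u* a.e. where q>0, one exists iff u* (set to 0 where q=0) is in L^2, and H(u* ) is always the infimum. *)

theory Defs
  imports "HOL-Probability.Probability"
begin

definition C1_on :: "real set \<Rightarrow> (real \<Rightarrow> real) \<Rightarrow> bool" where
  "C1_on S F \<longleftrightarrow>
     (\<exists>F'. continuous_on S F' \<and> (\<forall>x\<in>S. (F has_real_derivative F' x) (at x within S)))"

(* Representatives rather than classes modulo null sets; values outside S are irrelevant. *)
definition L2_on :: "real set \<Rightarrow> (real \<Rightarrow> real) set" where
  "L2_on S = {u. set_borel_measurable lborel S u \<and> set_integrable lborel S (\<lambda>t. (u t)\<^sup>2)}"

definition sigma_var :: "'a measure \<Rightarrow> ('a \<Rightarrow> real) \<Rightarrow> 'a set set" where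
  "sigma_var M X = {X -` A \<inter> space M |A. A \<in> sets borel}"

definition sigma_process :: "'a measure \<Rightarrow> real set \<Rightarrow> (real \<Rightarrow> 'a \<Rightarrow> real) \<Rightarrow> 'a set set" where
  "sigma_process M S D = sigma_sets (space M) (\<Union>t\<in>S. sigma_var M (D t))"

definition I_obs :: "real \<Rightarrow> real \<Rightarrow> real set" where
  "I_obs lmin T = {1 / lmin .. T}"

definition I_ctrl :: "real \<Rightarrow> real \<Rightarrow> real set" where
  "I_ctrl lmax T = {0 .. T - 1 / lmax}"

definition Lam :: "real \<Rightarrow> real \<Rightarrow> real \<Rightarrow> real \<Rightarrow> real set" where
  "Lam lmin lmax T t = {l \<in> {lmin..lmax}. 1 / lmin \<le> t + 1 / l \<and> t + 1 / l \<le> T}"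

definition q :: "(real \<Rightarrow> real) \<Rightarrow> real \<Rightarrow> real \<Rightarrow> real \<Rightarrow> real \<Rightarrow> real" where
  "q phi lmin lmax T t = (LINT l:Lam lmin lmax T t|lborel. phi l)"

definition mean_demand :: "'a measure \<Rightarrow> (real \<Rightarrow> 'a \<Rightarrow> real) \<Rightarrow> real \<Rightarrow> real" where
  "mean_demand M D t = (LINT \<omega>|M. D t \<omega>)"

(* Extended-valued, so that a divergent objective is infinite instead of 0, which is
   the value the Bochner integral would give it. *)
definition H ::
  "'a measure \<Rightarrow> ('a \<Rightarrow> real) \<Rightarrow> (real \<Rightarrow> 'a \<Rightarrow> real) \<Rightarrow> real \<Rightarrow> real \<Rightarrow> (real \<Rightarrow> real) \<Rightarrow> ennreal" where
  "H M lam D lmin T u =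
     (\<integral>\<^sup>+ s \<in> I_obs lmin T.
        (\<integral>\<^sup>+ \<omega>. ennreal ((u (s - 1 / lam \<omega>) - D s \<omega>)\<^sup>2) \<partial>M) \<partial>lborel)"

definition optimal_control ::
  "'a measure \<Rightarrow> ('a \<Rightarrow> real) \<Rightarrow> (real \<Rightarrow> 'a \<Rightarrow> real) \<Rightarrow> real \<Rightarrow> real \<Rightarrow> real \<Rightarrow> (real \<Rightarrow> real) \<Rightarrow> bool" where
  "optimal_control M lam D lmin lmax T u \<longleftrightarrow>
     u \<in> L2_on (I_ctrl lmax T) \<and>
     (\<forall>v \<in> L2_on (I_ctrl lmax T). H M lam D lmin T u \<le> H M lam D lmin T v)"

(* Where q vanishes, division by zero makes this 0; H does not depend on that choice. *)
definition ustar ::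
  "'a measure \<Rightarrow> (real \<Rightarrow> 'a \<Rightarrow> real) \<Rightarrow> (real \<Rightarrow> real) \<Rightarrow> real \<Rightarrow> real \<Rightarrow> real \<Rightarrow> real \<Rightarrow> real" where
  "ustar M D phi lmin lmax T t =
     (LINT l:Lam lmin lmax T t|lborel. mean_demand M D (t + 1 / l) * phi l) / q phi lmin lmax T t"

definition obs_event :: "'a measure \<Rightarrow> ('a \<Rightarrow> real) \<Rightarrow> real \<Rightarrow> real \<Rightarrow> real \<Rightarrow> 'a set" where
  "obs_event M lam lmin T t = {\<omega> \<in> space M. t + 1 / lam \<omega> \<in> I_obs lmin T}"

(* Elementary conditional expectation; meaningful only when A has positive probability. *)
definition cond_expectation :: "'a measure \<Rightarrow> ('a \<Rightarrow> real) \<Rightarrow> 'a set \<Rightarrow> real" where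
  "cond_expectation M X A = (LINT \<omega>:A|M. X \<omega>) / measure M A"

end

theory Submission imports Defs begin

text \<open>
  Substituting \<open>s = t + 1 / lam \<omega>\<close> for each \<open>\<omega>\<close> turns \<open>H u\<close> into an integral over control times \<open>t\<close> of
  the second moment of \<open>u t - D (t + 1 / lam \<omega>) \<omega>\<close> on the event that \<open>t + 1 / lam \<omega>\<close> is observed.
  That event has probability \<open>q t\<close>, so completing the square pointwise in \<open>t\<close> gives
  \<open>H u = H r + \<integral> q t * (u t - r t)\<^sup>2 dt\<close>, where \<open>r\<close> is the conditional expectation of the delayed
  demand. As \<open>r\<close> need not be square integrable, it is approximated by its truncations to obtain
  the infimum over \<open>L2\<close>.

  Independence identifies \<open>r\<close> with \<open>ustar\<close>, but only for almost every \<open>t\<close>: as \<open>D\<close> need not be jointly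
  measurable with respect to the sigma-algebra it generates, independence is available only at a
  fixed observation time \<open>s\<close>. It is used there, and the result is carried back to control times
  by testing against Borel sets of \<open>t\<close>.
\<close>

section \<open>Shifting time by a random delay, and independence at a fixed time\<close>

text \<open>Tonelli puts the time integral inside, where for fixed \<open>\<omega>\<close> the delay
  \<open>c \<omega>\<close> is a constant and Lebesgue measure is translation invariant. The measure
  is kept general because the shift is applied both to \<open>M\<close> and to the law of a random
  variable.\<close>

lemma nn_integral_shift:
  fixes c :: "'a \<Rightarrow> real" and g :: "real \<Rightarrow> 'a \<Rightarrow> ennreal"
  assumes "sigma_finite_measure M"
    and [measurable]: "c \<in> borel_measurable M"
    and [measurable]: "case_prod g \<in> borel_measurable (borel \<Otimes>\<^sub>M M)"
  shows "(\<integral>\<^sup>+ s. (\<integral>\<^sup>+ \<omega>. g s \<omega> \<partial>M) \<partial>lborel) = (\<integral>\<^sup>+ t. (\<integral>\<^sup>+ \<omega>. g (t + c \<omega>) \<omega> \<partial>M) \<partial>lborel)"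
proof -
  interpret sigma_finite_measure M by fact
  interpret pair_sigma_finite lborel M ..
  have "(\<integral>\<^sup>+ s. (\<integral>\<^sup>+ \<omega>. g s \<omega> \<partial>M) \<partial>lborel) = (\<integral>\<^sup>+ \<omega>. (\<integral>\<^sup>+ s. g s \<omega> \<partial>lborel) \<partial>M)"
    by (rule Fubini'[symmetric]) simp
  also have "\<dots> = (\<integral>\<^sup>+ \<omega>. (\<integral>\<^sup>+ t. g (t + c \<omega>) \<omega> \<partial>lborel) \<partial>M)"
  proof (rule nn_integral_cong)
    fix \<omega> assume [measurable]: "\<omega> \<in> space M"
    have "(\<lambda>s. g s \<omega>) \<in> borel_measurable borel"
      by simp
    from nn_integral_real_affine[OF this, of 1 "c \<omega>"]
    show "(\<integral>\<^sup>+ s. g s \<omega> \<partial>lborel) = (\<integral>\<^sup>+ t. g (t + c \<omega>) \<omega> \<partial>lborel)"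
      by (simp add: add.commute)
  qed
  also have "\<dots> = (\<integral>\<^sup>+ t. (\<integral>\<^sup>+ \<omega>. g (t + c \<omega>) \<omega> \<partial>M) \<partial>lborel)"
    by (rule Fubini') simp
  finally show ?thesis .
qed

lemma Int_stable_sigma_var: "Int_stable (sigma_var M X)"
proof (rule Int_stableI)
  fix a b assume "a \<in> sigma_var M X" "b \<in> sigma_var M X"
  then obtain A B where "A \<in> sets borel" "B \<in> sets borel"
    "a = X -` A \<inter> space M" "b = X -` B \<inter> space M"
    unfolding sigma_var_def by blast
  then show "a \<inter> b \<in> sigma_var M X"
    unfolding sigma_var_def by (intro CollectI exI[of _ "A \<inter> B"]) auto
qed

lemma (in prob_space) nn_integral_indep_sigma_var:
  assumes [measurable]: "X \<in> borel_measurable M" "Y \<in> borel_measurable M"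
    and indep: "indep_set (sigma_var M X) (sigma_var M Y)"
    and [measurable]: "case_prod h \<in> borel_measurable (borel \<Otimes>\<^sub>M borel)"
  shows "(\<integral>\<^sup>+ \<omega>. h (X \<omega>) (Y \<omega>) \<partial>M) = (\<integral>\<^sup>+ l. (\<integral>\<^sup>+ \<omega>. h l (Y \<omega>) \<partial>M) \<partial>distr M borel X)"
proof -
  interpret Y: prob_space "distr M borel Y"
    by (rule prob_space_distr) simp
  \<comment> \<open>\<open>indep_var_eq\<close> speaks of generated sigma-algebras; intersection
    stability of the generators carries independence over to them.\<close>
  have "indep_var borel X borel Y"
    using indep_set_sigma_sets[OF indep Int_stable_sigma_var Int_stable_sigma_var]
    unfolding indep_var_eq sigma_var_def by simp
  then have joint: "distr M borel X \<Otimes>\<^sub>M distr M borel Y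
      = distr M (borel \<Otimes>\<^sub>M borel) (\<lambda>\<omega>. (X \<omega>, Y \<omega>))"
    unfolding indep_var_distribution_eq by simp
  have "(\<integral>\<^sup>+ \<omega>. h (X \<omega>) (Y \<omega>) \<partial>M)
      = (\<integral>\<^sup>+ z. case_prod h z \<partial>distr M (borel \<Otimes>\<^sub>M borel) (\<lambda>\<omega>. (X \<omega>, Y \<omega>)))"
    by (subst nn_integral_distr) auto
  also have "\<dots> = (\<integral>\<^sup>+ l. (\<integral>\<^sup>+ y. h l y \<partial>distr M borel Y) \<partial>distr M borel X)"
    unfolding joint[symmetric] by (subst Y.nn_integral_fst[symmetric]) auto
  also have "\<dots> = (\<integral>\<^sup>+ l. (\<integral>\<^sup>+ \<omega>. h l (Y \<omega>) \<partial>M) \<partial>distr M borel X)"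
    by (intro nn_integral_cong) (subst nn_integral_distr, auto)
  finally show ?thesis .
qed

lemma (in prob_space) AE_decouple_delay:
  fixes c :: "real \<Rightarrow> real" and Y :: "real \<Rightarrow> 'a \<Rightarrow> real"
  assumes [measurable]: "X \<in> borel_measurable M" "c \<in> borel_measurable borel"
      "case_prod Y \<in> borel_measurable (borel \<Otimes>\<^sub>M M)" "S \<in> sets borel"
    and indep: "\<And>s. s \<in> S \<Longrightarrow> indep_set (sigma_var M X) (sigma_var M (Y s))"
  shows "AE t in lborel.
    (\<integral>\<^sup>+ \<omega>. indicator S (t + c (X \<omega>)) * ennreal (Y (t + c (X \<omega>)) \<omega>) \<partial>M) =
    (\<integral>\<^sup>+ l. (\<integral>\<^sup>+ \<omega>. indicator S (t + c l) * ennreal (Y (t + c l) \<omega>) \<partial>M) \<partial>distr M borel X)"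
proof (rule sigma_finite_measure.density_unique2[OF lborel.sigma_finite_measure_axioms])
  interpret X: prob_space "distr M borel X"
    by (rule prob_space_distr) simp
  interpret XM: pair_prob_space "distr M borel X" M ..
  have sfM: "sigma_finite_measure M" ..
  have sfX: "sigma_finite_measure (distr M borel X)" ..
  show "(\<lambda>t. \<integral>\<^sup>+ \<omega>. indicator S (t + c (X \<omega>)) * ennreal (Y (t + c (X \<omega>)) \<omega>) \<partial>M)
      \<in> borel_measurable lborel"
    by measurable
  show "(\<lambda>t. \<integral>\<^sup>+ l. (\<integral>\<^sup>+ \<omega>. indicator S (t + c l) * ennreal (Y (t + c l) \<omega>) \<partial>M) \<partial>distr M borel X)
      \<in> borel_measurable lborel"
    by measurable
  fix A :: "real set" assume "A \<in> sets lborel"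
  then have [measurable]: "A \<in> sets borel" by simp
  \<comment> \<open>For \<open>s = t + c x\<close> the second factor tests \<open>t \<in> A\<close>,
    so the test set on control times becomes a condition on \<open>X\<close> at a given
    \<open>s\<close>.\<close>
  define g where "g s x y = indicator S s * indicator A (s - c x) * ennreal y"
    for s x y :: real
  have [measurable (raw)]: "(\<lambda>z. g (a z) (b z) (d z)) \<in> borel_measurable N"
    if [measurable]: "a \<in> borel_measurable N" "b \<in> borel_measurable N" "d \<in> borel_measurable N"
    for a b d and N :: "'z measure"
    unfolding g_def by measurable
  have "(\<integral>\<^sup>+ t\<in>A. (\<integral>\<^sup>+ \<omega>. indicator S (t + c (X \<omega>)) * ennreal (Y (t + c (X \<omega>)) \<omega>) \<partial>M) \<partial>lborel)
      = (\<integral>\<^sup>+ t. (\<integral>\<^sup>+ \<omega>. g (t + c (X \<omega>)) (X \<omega>) (Y (t + c (X \<omega>)) \<omega>) \<partial>M) \<partial>lborel)"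
    unfolding g_def
    by (intro nn_integral_cong) (simp add: nn_integral_cmult[symmetric] ac_simps)
  also have "\<dots> = (\<integral>\<^sup>+ s. (\<integral>\<^sup>+ \<omega>. g s (X \<omega>) (Y s \<omega>) \<partial>M) \<partial>lborel)"
    by (rule nn_integral_shift[OF sfM, symmetric]) simp_all
  also have "\<dots> = (\<integral>\<^sup>+ s. (\<integral>\<^sup>+ l. (\<integral>\<^sup>+ \<omega>. g s l (Y s \<omega>) \<partial>M) \<partial>distr M borel X) \<partial>lborel)"
  proof (rule nn_integral_cong)
    fix s :: real
    show "(\<integral>\<^sup>+ \<omega>. g s (X \<omega>) (Y s \<omega>) \<partial>M)
        = (\<integral>\<^sup>+ l. (\<integral>\<^sup>+ \<omega>. g s l (Y s \<omega>) \<partial>M) \<partial>distr M borel X)"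
    proof (cases "s \<in> S")
      case True
      show ?thesis
        by (rule nn_integral_indep_sigma_var[OF _ _ indep[OF True]]) simp_all
    qed (simp add: g_def)
  qed
  \<comment> \<open>The shift back takes place over the law of \<open>X\<close>, with the delay
    depending on the value \<open>l\<close> alone.\<close>
  also have "\<dots> = (\<integral>\<^sup>+ t. (\<integral>\<^sup>+ l. (\<integral>\<^sup>+ \<omega>. g (t + c l) l (Y (t + c l) \<omega>) \<partial>M) \<partial>distr M borel X) \<partial>lborel)"
    by (rule nn_integral_shift[OF sfX]) simp_all
  also have "\<dots> = (\<integral>\<^sup>+ t\<in>A. (\<integral>\<^sup>+ l. (\<integral>\<^sup>+ \<omega>. indicator S (t + c l) * ennreal (Y (t + c l) \<omega>) \<partial>M) \<partial>distr M borel X) \<partial>lborel)"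
    unfolding g_def
    by (intro nn_integral_cong) (simp add: nn_integral_cmult[symmetric] ac_simps)
  finally show "(\<integral>\<^sup>+ t\<in>A. (\<integral>\<^sup>+ \<omega>. indicator S (t + c (X \<omega>)) * ennreal (Y (t + c (X \<omega>)) \<omega>) \<partial>M) \<partial>lborel) = \<dots>" .
qed

section \<open>Square deviation on an event, and extension by zero\<close>

lemma (in prob_space) set_square_integrable_imp_set_integrable:
  fixes X :: "'a \<Rightarrow> real"
  assumes [measurable]: "A \<in> sets M" "X \<in> borel_measurable M"
    and sq: "set_integrable M A (\<lambda>\<omega>. (X \<omega>)\<^sup>2)"
  shows "set_integrable M A X"
  unfolding set_integrable_def
proof (rule Bochner_Integration.integrable_bound)
  show "integrable M (\<lambda>\<omega>. 1 + indicator A \<omega> *\<^sub>R (X \<omega>)\<^sup>2)"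
    using sq by (auto simp: set_integrable_def)
  \<comment> \<open>The majorant is integrable because constants are, the measure being
    finite.\<close>
  have "\<bar>x\<bar> \<le> 1 + x\<^sup>2" for x :: real
    using zero_le_power2[of "\<bar>x\<bar> - 1"] by (auto simp: power2_eq_square algebra_simps)
  then show "AE \<omega> in M. norm (indicator A \<omega> *\<^sub>R X \<omega>) \<le> norm (1 + indicator A \<omega> *\<^sub>R (X \<omega>)\<^sup>2)"
    by (auto simp: indicator_def)
qed simp

text \<open>The condition on \<open>y\<close> avoids division: it covers the null event, where \<open>y\<close> is arbitrary.\<close>

lemma (in prob_space) set_square_deviation_split:
  assumes [measurable]: "A \<in> sets M" "X \<in> borel_measurable M"
    and sq: "set_integrable M A (\<lambda>\<omega>. (X \<omega>)\<^sup>2)"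
    and y: "prob A * y = (LINT \<omega>:A|M. X \<omega>)"
  shows "(\<integral>\<^sup>+ \<omega>. indicator A \<omega> * ennreal ((x - X \<omega>)\<^sup>2) \<partial>M)
    = (\<integral>\<^sup>+ \<omega>. indicator A \<omega> * ennreal ((y - X \<omega>)\<^sup>2) \<partial>M) + ennreal (prob A * (x - y)\<^sup>2)"
proof -
  have int_X: "integrable M (\<lambda>\<omega>. indicator A \<omega> * X \<omega>)"
    and int_sq: "integrable M (\<lambda>\<omega>. indicator A \<omega> * (X \<omega>)\<^sup>2)"
    and int_A: "integrable M (\<lambda>\<omega>. indicator A \<omega> :: real)"
    using set_square_integrable_imp_set_integrable[OF _ _ sq] sq
    by (simp_all add: set_integrable_def integrable_indicator_iff emeasure_eq_measure)
  have expand: "indicator A \<omega> * (z - X \<omega>)\<^sup>2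
      = z\<^sup>2 * indicator A \<omega> - 2 * z * (indicator A \<omega> * X \<omega>) + indicator A \<omega> * (X \<omega>)\<^sup>2" for z \<omega>
    by (simp add: power2_eq_square algebra_simps)
  have int: "integrable M (\<lambda>\<omega>. indicator A \<omega> * (z - X \<omega>)\<^sup>2)" for z
    unfolding expand using int_X int_sq int_A by simp
  have val: "(LINT \<omega>|M. indicator A \<omega> * (z - X \<omega>)\<^sup>2)
      = z\<^sup>2 * prob A - 2 * z * (prob A * y) + (LINT \<omega>|M. indicator A \<omega> * (X \<omega>)\<^sup>2)" for z
    unfolding expand y set_lebesgue_integral_def using int_X int_sq int_A by simp
  have nn: "(\<integral>\<^sup>+ \<omega>. indicator A \<omega> * ennreal ((z - X \<omega>)\<^sup>2) \<partial>M)
      = ennreal (LINT \<omega>|M. indicator A \<omega> * (z - X \<omega>)\<^sup>2)" for z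
    by (subst nn_integral_eq_integral[OF int, symmetric])
      (auto simp: ennreal_mult' ennreal_indicator)
  \<comment> \<open>Taking \<open>val\<close> at \<open>z = x\<close> and at \<open>z = y\<close>,
    the second moments of \<open>X\<close> cancel, and the terms in \<open>prob A\<close> combine to
    a square.\<close>
  have "(LINT \<omega>|M. indicator A \<omega> * (x - X \<omega>)\<^sup>2)
      = (LINT \<omega>|M. indicator A \<omega> * (y - X \<omega>)\<^sup>2) + prob A * (x - y)\<^sup>2"
    unfolding val by (simp add: power2_eq_square algebra_simps)
  then show ?thesis
    unfolding nn by (subst ennreal_plus[symmetric]) auto
qed

text \<open>On the restriction of the product to \<open>S \<times> space M\<close> the identity is
  measurable into the product with the restricted factor, so \<open>D\<close> is measurable there
  and multiplication by the indicator extends it to the whole line.\<close>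

lemma borel_measurable_zero_extension:
  fixes D :: "real \<Rightarrow> 'a \<Rightarrow> real"
  assumes [measurable]: "S \<in> sets borel"
    and D: "case_prod D \<in> borel_measurable (restrict_space borel S \<Otimes>\<^sub>M M)"
  shows "(\<lambda>(t, \<omega>). indicator S t * D t \<omega>) \<in> borel_measurable (borel \<Otimes>\<^sub>M M)"
proof -
  let ?R = "restrict_space (borel \<Otimes>\<^sub>M M) (S \<times> space M)"
  have "fst \<in> ?R \<rightarrow>\<^sub>M restrict_space borel S"
    by (rule measurable_restrict_space2) (auto simp: space_restrict_space intro: measurable_restrict_space1)
  moreover have "snd \<in> ?R \<rightarrow>\<^sub>M M"
    by (rule measurable_restrict_space1) simp
  ultimately have "(\<lambda>z. (fst z, snd z)) \<in> ?R \<rightarrow>\<^sub>M restrict_space borel S \<Otimes>\<^sub>M M"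
    by (rule measurable_Pair)
  from measurable_compose[OF this D]
  have "case_prod D \<in> borel_measurable ?R" by simp
  then have "(\<lambda>z. indicator (S \<times> space M) z *\<^sub>R case_prod D z) \<in> borel_measurable (borel \<Otimes>\<^sub>M M)"
    by (subst (asm) borel_measurable_restrict_space_iff) auto
  then show ?thesis
    by (rule measurable_cong[THEN iffD1, rotated])
      (auto simp: space_pair_measure indicator_def)
qed

section \<open>Minimizing a functional with a weighted quadratic excess\<close>

text \<open>The excess of \<open>F u\<close> over \<open>F r\<close> is a weighted squared distance,
  so \<open>r\<close> is the best candidate even when it lies outside \<open>L2_on S\<close>;
  truncations of \<open>r\<close> show that the infimum over \<open>L2_on S\<close> is still
  \<open>F r\<close>. Fixing \<open>r = 0\<close> where the weight vanishes makes membership of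
  \<open>r\<close> in \<open>L2_on S\<close> decide existence.\<close>

lemma weighted_L2_minimum:
  fixes w r :: "real \<Rightarrow> real" and F :: "(real \<Rightarrow> real) \<Rightarrow> ennreal"
  assumes [measurable]: "S \<in> sets borel" and fin: "emeasure lborel S < \<infinity>"
    and w[measurable]: "w \<in> borel_measurable borel" and w_nonneg: "\<And>t. 0 \<le> w t"
    and r: "set_borel_measurable lborel S r" and r_zero: "\<And>t. t \<in> S \<Longrightarrow> w t = 0 \<Longrightarrow> r t = 0"
    and F: "\<And>u. set_borel_measurable lborel S u \<Longrightarrow>
      F u = F r + (\<integral>\<^sup>+ t\<in>S. ennreal (w t * (u t - r t)\<^sup>2) \<partial>lborel)"
    and F0: "F (\<lambda>_. 0) < \<infinity>"
  shows weighted_L2_minimum_value: "F r = (INF v\<in>L2_on S. F v)"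
    and weighted_L2_minimum_iff: "u \<in> L2_on S \<and> (\<forall>v\<in>L2_on S. F u \<le> F v) \<longleftrightarrow>
      u \<in> L2_on S \<and> (AE t\<in>S in lborel. 0 < w t \<longrightarrow> u t = r t)"
    and weighted_L2_minimum_exists:
      "(\<exists>u. u \<in> L2_on S \<and> (\<forall>v\<in>L2_on S. F u \<le> F v)) \<longleftrightarrow> r \<in> L2_on S"
    and weighted_L2_minimum_finite: "F r < \<infinity>"
proof -
  have zero: "set_borel_measurable lborel S (\<lambda>_. 0 :: real)"
    by (simp add: set_borel_measurable_def)
  have meas: "(\<lambda>t. ennreal (w t * (u t - r t)\<^sup>2) * indicator S t) \<in> borel_measurable lborel"
    if "set_borel_measurable lborel S u" for u
  proof -
    have [measurable]: "(\<lambda>t. indicator S t * u t) \<in> borel_measurable borel"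
        "(\<lambda>t. indicator S t * r t) \<in> borel_measurable borel"
      using that r by (simp_all add: set_borel_measurable_def)
    \<comment> \<open>Only the products with the indicator are known to be measurable on the whole
      line; the outer indicator makes the inner ones harmless.\<close>
    have "(\<lambda>t. ennreal (w t * (indicator S t * u t - indicator S t * r t)\<^sup>2) * indicator S t)
        \<in> borel_measurable lborel"
      by measurable
    then show ?thesis
      by (rule measurable_cong[THEN iffD1, rotated]) (auto simp: indicator_def)
  qed
  have L2_meas: "set_borel_measurable lborel S u" if "u \<in> L2_on S" for u
    using that by (simp add: L2_on_def)
  have ge: "F r \<le> F v" if "set_borel_measurable lborel S v" for v
    using F[OF that] by simp
  show finite: "F r < \<infinity>"
    using ge[OF zero] F0 by simp
  \<comment> \<open>Each \<open>v n\<close> is bounded on a set of finite measure, hence square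
    integrable, and its error is at every point either that of \<open>r\<close> or that of the zero
    control.\<close>
  define v where "v n t = (if \<bar>r t\<bar> \<le> real n then r t else 0)" for n t
  have v_meas: "set_borel_measurable lborel S (v n)" for n
  proof -
    have [measurable]: "(\<lambda>t. indicator S t * r t) \<in> borel_measurable borel"
      using r by (simp add: set_borel_measurable_def)
    have "(\<lambda>t. if \<bar>indicator S t * r t\<bar> \<le> real n then indicator S t * r t else 0)
        \<in> borel_measurable lborel"
      by measurable
    then show ?thesis
      unfolding set_borel_measurable_def
      by (rule measurable_cong[THEN iffD1, rotated]) (auto simp: indicator_def v_def)
  qed
  have v_L2: "v n \<in> L2_on S" for n
    unfolding L2_on_def
  proof (intro CollectI conjI v_meas)
    have [measurable]: "(\<lambda>t. indicator S t * v n t) \<in> borel_measurable lborel"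
      using v_meas[of n] by (simp add: set_borel_measurable_def)
    have "(\<lambda>t. (indicator S t * v n t)\<^sup>2) \<in> borel_measurable lborel"
      by measurable
    then have m: "(\<lambda>t. indicator S t * (v n t)\<^sup>2) \<in> borel_measurable lborel"
      by (rule measurable_cong[THEN iffD1, rotated]) (auto simp: indicator_def)
    have "integrable lborel (\<lambda>t. (real n)\<^sup>2 * indicator S t)"
      using fin by simp
    then show "set_integrable lborel S (\<lambda>t. (v n t)\<^sup>2)"
      unfolding set_integrable_def
      by (rule Bochner_Integration.integrable_bound)
        (use m in \<open>auto simp: v_def indicator_def power2_le_iff_abs_le\<close>)
  qed
  have "(\<lambda>n. \<integral>\<^sup>+ t. ennreal (w t * (v n t - r t)\<^sup>2) * indicator S t \<partial>lborel)
      \<longlonglongrightarrow> (\<integral>\<^sup>+ t. 0 \<partial>(lborel :: real measure))"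
  proof (rule nn_integral_dominated_convergence)
    show "(\<lambda>t. ennreal (w t * (v n t - r t)\<^sup>2) * indicator S t) \<in> borel_measurable lborel" for n
      by (rule meas[OF v_meas])
    show "(\<lambda>t. ennreal (w t * (0 - r t)\<^sup>2) * indicator S t) \<in> borel_measurable lborel"
      by (rule meas[OF zero])
    show "AE t in lborel. ennreal (w t * (v n t - r t)\<^sup>2) * indicator S t
        \<le> ennreal (w t * (0 - r t)\<^sup>2) * indicator S t" for n
      by (auto simp: v_def indicator_def w_nonneg)
    \<comment> \<open>The dominating integral is the excess at the zero control, which is at most
      \<open>F (\<lambda>_. 0)\<close>.\<close>
    show "(\<integral>\<^sup>+ t\<in>S. ennreal (w t * (0 - r t)\<^sup>2) \<partial>lborel) < \<infinity>"
      using F[OF zero] F0 by simp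
    show "AE t in lborel. (\<lambda>n. ennreal (w t * (v n t - r t)\<^sup>2) * indicator S t) \<longlonglongrightarrow> 0"
    proof (rule AE_I2, rule tendsto_eventually)
      fix t :: real
      have "v n t = r t" if "nat \<lceil>\<bar>r t\<bar>\<rceil> \<le> n" for n
        using that by (auto simp: v_def)
      then show "\<forall>\<^sub>F n in sequentially. ennreal (w t * (v n t - r t)\<^sup>2) * indicator S t = 0"
        unfolding eventually_sequentially by (intro exI[of _ "nat \<lceil>\<bar>r t\<bar>\<rceil>"]) simp
    qed
  qed simp
  then have "(\<lambda>n. F r + (\<integral>\<^sup>+ t. ennreal (w t * (v n t - r t)\<^sup>2) * indicator S t \<partial>lborel)) \<longlonglongrightarrow> F r + 0"
    by (intro tendsto_add tendsto_const) simp
  then have lim: "(\<lambda>n. F (v n)) \<longlonglongrightarrow> F r"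
    by (simp add: F[OF v_meas])
  show r_eq_INF: "F r = (INF v\<in>L2_on S. F v)"
  proof (rule antisym)
    show "F r \<le> (INF v\<in>L2_on S. F v)"
      by (rule INF_greatest) (rule ge[OF L2_meas])
    show "(INF v\<in>L2_on S. F v) \<le> F r"
      by (rule LIMSEQ_le_const[OF lim]) (auto intro!: INF_lower v_L2)
  qed
  show iff: "u \<in> L2_on S \<and> (\<forall>v\<in>L2_on S. F u \<le> F v) \<longleftrightarrow>
      u \<in> L2_on S \<and> (AE t\<in>S in lborel. 0 < w t \<longrightarrow> u t = r t)" for u
  proof (cases "u \<in> L2_on S")
    case True
    then have u: "set_borel_measurable lborel S u"
      by (rule L2_meas)
    \<comment> \<open>Comparison with all competitors reduces to comparison with \<open>r\<close>,
      which need not be a competitor itself. Finiteness of \<open>F r\<close> then permits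
      cancelling it in \<open>ennreal\<close>.\<close>
    have "(\<forall>v\<in>L2_on S. F u \<le> F v) \<longleftrightarrow> F u \<le> F r"
      unfolding r_eq_INF by (simp add: le_INF_iff)
    also have "\<dots> \<longleftrightarrow> (\<integral>\<^sup>+ t\<in>S. ennreal (w t * (u t - r t)\<^sup>2) \<partial>lborel) = 0"
    proof
      assume "F u \<le> F r"
      then have "F r + (\<integral>\<^sup>+ t\<in>S. ennreal (w t * (u t - r t)\<^sup>2) \<partial>lborel) \<le> F r + 0"
        by (simp add: F[OF u])
      then show "(\<integral>\<^sup>+ t\<in>S. ennreal (w t * (u t - r t)\<^sup>2) \<partial>lborel) = 0"
        using finite by (subst (asm) ennreal_add_left_cancel_le) auto
    qed (simp add: F[OF u])
    also have "\<dots> \<longleftrightarrow> (AE t in lborel. ennreal (w t * (u t - r t)\<^sup>2) * indicator S t = 0)"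
      by (rule nn_integral_0_iff_AE[OF meas[OF u]])
    also have "\<dots> \<longleftrightarrow> (AE t\<in>S in lborel. 0 < w t \<longrightarrow> u t = r t)"
    proof (rule AE_cong)
      fix t
      show "ennreal (w t * (u t - r t)\<^sup>2) * indicator S t = 0 \<longleftrightarrow> (t \<in> S \<longrightarrow> 0 < w t \<longrightarrow> u t = r t)"
        using w_nonneg[of t]
        by (cases "w t = 0") (auto simp: indicator_def ennreal_eq_0_iff mult_le_0_iff)
    qed
    finally show ?thesis by simp
  qed simp
  show "(\<exists>u. u \<in> L2_on S \<and> (\<forall>v\<in>L2_on S. F u \<le> F v)) \<longleftrightarrow> r \<in> L2_on S"
  proof
    assume "r \<in> L2_on S"
    then show "\<exists>u. u \<in> L2_on S \<and> (\<forall>v\<in>L2_on S. F u \<le> F v)"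
      using ge L2_meas by blast
  next
    assume "\<exists>u. u \<in> L2_on S \<and> (\<forall>v\<in>L2_on S. F u \<le> F v)"
    then obtain u where u: "u \<in> L2_on S" and ae: "AE t\<in>S in lborel. 0 < w t \<longrightarrow> u t = r t"
      using iff by blast
    have [measurable]: "(\<lambda>t. indicator S t * r t) \<in> borel_measurable lborel"
      using r by (simp add: set_borel_measurable_def)
    have "(\<lambda>t. (indicator S t * r t)\<^sup>2) \<in> borel_measurable lborel"
      by measurable
    then have m: "(\<lambda>t. indicator S t * (r t)\<^sup>2) \<in> borel_measurable lborel"
      by (rule measurable_cong[THEN iffD1, rotated]) (auto simp: indicator_def)
    have "set_integrable lborel S (\<lambda>t. (r t)\<^sup>2)"
      unfolding set_integrable_def
    proof (rule Bochner_Integration.integrable_bound)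
      show "integrable lborel (\<lambda>t. indicator S t *\<^sub>R (u t)\<^sup>2)"
        using u by (simp add: L2_on_def set_integrable_def)
      \<comment> \<open>A minimizer equals \<open>r\<close> almost everywhere on \<open>S\<close>
        where the weight is positive; elsewhere on \<open>S\<close>, \<open>r\<close> is
        zero.\<close>
      show "AE t in lborel. norm (indicator S t *\<^sub>R (r t)\<^sup>2) \<le> norm (indicator S t *\<^sub>R (u t)\<^sup>2)"
        using ae
      proof eventually_elim
        case (elim t)
        show ?case
          using elim w_nonneg[of t] r_zero[of t] by (cases "w t = 0") (auto simp: indicator_def)
      qed
    qed (use m in simp)
    then show "r \<in> L2_on S"
      using r by (simp add: L2_on_def)
  qed
qed

section \<open>The objective in control time\<close>

text \<open>Here \<open>D\<close> is defined measurably on the whole line, so that delayed times can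
  be substituted freely, while square integrability and independence are asked for at observation
  times only.\<close>

locale outflow_tracking = prob_space M for M :: "'a measure" +
  fixes lam :: "'a \<Rightarrow> real" and D :: "real \<Rightarrow> 'a \<Rightarrow> real" and phi :: "real \<Rightarrow> real"
    and lmin lmax T :: real
  assumes lmin_pos: "0 < lmin"
    and lam_measurable[measurable]: "lam \<in> borel_measurable M"
    and lam_bounds: "AE \<omega> in M. lmin \<le> lam \<omega> \<and> lam \<omega> \<le> lmax"
    and phi_nonneg: "\<And>l. 0 \<le> phi l"
    and lam_density: "distributed M lborel lam (\<lambda>l. ennreal (phi l))"
    and D_measurable[measurable]: "case_prod D \<in> borel_measurable (borel \<Otimes>\<^sub>M M)"
    and D_nonneg: "\<And>t \<omega>. \<omega> \<in> space M \<Longrightarrow> 0 \<le> D t \<omega>"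
    and D_square_finite:
      "(\<integral>\<^sup>+ s\<in>I_obs lmin T. (\<integral>\<^sup>+ \<omega>. ennreal ((D s \<omega>)\<^sup>2) \<partial>M) \<partial>lborel) < \<infinity>"
    and indep_at: "\<And>s. s \<in> I_obs lmin T \<Longrightarrow> indep_set (sigma_var M lam) (sigma_var M (D s))"
begin

abbreviation (input) A where "A t \<equiv> obs_event M lam lmin T t"
abbreviation (input) X where "X t \<omega> \<equiv> D (t + 1 / lam \<omega>) \<omega>"
abbreviation (input) qq where "qq t \<equiv> q phi lmin lmax T t"
abbreviation (input) us where "us t \<equiv> ustar M D phi lmin lmax T t"
abbreviation (input) ctrl where "ctrl \<equiv> I_ctrl lmax T"

lemma I_obs_measurable[measurable]: "I_obs lmin T \<in> sets borel"
  by (simp add: I_obs_def)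

lemma I_ctrl_measurable[measurable]: "I_ctrl lmax T \<in> sets borel"
  by (simp add: I_ctrl_def)

lemma phi_measurable[measurable]: "phi \<in> borel_measurable borel"
proof -
  have "(\<lambda>l. enn2real (ennreal (phi l))) \<in> borel_measurable borel"
    using distributed_borel_measurable[OF lam_density] by measurable
  then show ?thesis
    by (simp add: phi_nonneg)
qed

lemma obs_event_measurable[measurable]: "A t \<in> events"
  unfolding obs_event_def by measurable

lemma indicator_obs_event:
  "\<omega> \<in> space M \<Longrightarrow> indicator (A t) \<omega> = indicator (I_obs lmin T) (t + 1 / lam \<omega>)"
  by (simp add: obs_event_def indicator_def)

lemma mean_demand_measurable[measurable]: "mean_demand M D \<in> borel_measurable borel"
  unfolding mean_demand_def[abs_def] by measurable

lemma mean_demand_nonneg: "0 \<le> mean_demand M D s"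
  unfolding mean_demand_def by (rule integral_nonneg_AE) (auto intro: D_nonneg)

lemma distr_lam: "distr M borel lam = density lborel (\<lambda>l. ennreal (phi l))"
  using distributed_distr_eq_density[OF lam_density] distr_cong[of M M borel lborel lam lam]
  by simp

text \<open>The almost sure bounds on \<open>lam\<close> say that its law, and hence its density,
  charges nothing outside the interval. This allows the bounds in \<open>Lam\<close> to be dropped
  under an integral against \<open>phi\<close>.\<close>

lemma AE_phi_support: "AE l in lborel. phi l = 0 \<or> l \<in> {lmin..lmax}"
proof -
  have "AE l in distr M borel lam. l \<in> {lmin..lmax}"
    using lam_bounds by (subst AE_distr_iff) auto
  then have "AE l in lborel. 0 < ennreal (phi l) \<longrightarrow> l \<in> {lmin..lmax}"
    unfolding distr_lam by (subst (asm) AE_density) auto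
  then show ?thesis
    by eventually_elim (use phi_nonneg in \<open>auto simp: less_le\<close>)
qed

lemma indicator_Lam:
  assumes "phi l = 0 \<or> l \<in> {lmin..lmax}"
  shows "indicator (Lam lmin lmax T t) l * phi l = indicator (I_obs lmin T) (t + 1 / l) * phi l"
  using assms by (auto simp: Lam_def I_obs_def indicator_def)

lemma Lam_measurable_pair[measurable]:
  "(\<lambda>(t, l). indicator (Lam lmin lmax T t) l :: real) \<in> borel_measurable (borel \<Otimes>\<^sub>M borel)"
proof -
  have "(\<lambda>(t, l). if lmin \<le> l \<and> l \<le> lmax \<and> 1 / lmin \<le> t + 1 / l \<and> t + 1 / l \<le> T then 1 else 0 :: real)
      \<in> borel_measurable (borel \<Otimes>\<^sub>M borel)"
    by measurable
  then show ?thesis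
    by (rule measurable_cong[THEN iffD1, rotated]) (auto simp: Lam_def indicator_def)
qed

lemma q_eq_prob: "qq t = prob (A t)"
proof -
  have "emeasure M (A t) = (\<integral>\<^sup>+ \<omega>. indicator (I_obs lmin T) (t + 1 / lam \<omega>) \<partial>M)"
    unfolding nn_integral_indicator[OF obs_event_measurable, symmetric]
    by (intro nn_integral_cong) (simp add: indicator_obs_event)
  also have "\<dots> = (\<integral>\<^sup>+ l. indicator (I_obs lmin T) (t + 1 / l) \<partial>distr M borel lam)"
    by (subst nn_integral_distr) auto
  also have "\<dots> = (\<integral>\<^sup>+ l. ennreal (phi l) * indicator (I_obs lmin T) (t + 1 / l) \<partial>lborel)"
    unfolding distr_lam by (subst nn_integral_density) auto
  also have "\<dots> = (\<integral>\<^sup>+ l. ennreal (indicator (Lam lmin lmax T t) l * phi l) \<partial>lborel)"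
  proof (rule nn_integral_cong_AE)
    show "AE l in lborel. ennreal (phi l) * indicator (I_obs lmin T) (t + 1 / l)
        = ennreal (indicator (Lam lmin lmax T t) l * phi l)"
      using AE_phi_support
      by eventually_elim (subst indicator_Lam, auto split: split_indicator)
  qed
  finally show ?thesis
    unfolding q_def set_lebesgue_integral_def measure_def
    by (simp add: integral_eq_nn_integral phi_nonneg)
qed

lemma q_measurable[measurable]: "q phi lmin lmax T \<in> borel_measurable borel"
  unfolding q_def[abs_def] set_lebesgue_integral_def by measurable

lemma ustar_measurable[measurable]: "ustar M D phi lmin lmax T \<in> borel_measurable borel"
  unfolding ustar_def[abs_def] set_lebesgue_integral_def by measurable

text \<open>For observation times \<open>s\<close> and admissible speeds the emission time
  \<open>s - 1 / lam \<omega>\<close> falls into the control interval, so cutting off there is free.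
  After the shift, the cutoff in \<open>s\<close> has become the event that
  \<open>t + 1 / lam \<omega>\<close> is observed.\<close>

lemma H_eq_control_integral:
  assumes u: "set_borel_measurable lborel ctrl u"
  shows "H M lam D lmin T u =
    (\<integral>\<^sup>+ t\<in>ctrl. (\<integral>\<^sup>+ \<omega>. indicator (A t) \<omega> * ennreal ((u t - X t \<omega>)\<^sup>2) \<partial>M) \<partial>lborel)"
proof -
  have sf: "sigma_finite_measure M" ..
  define u' where "u' t = indicator ctrl t * u t" for t
  have [measurable]: "u' \<in> borel_measurable borel"
    using u by (simp add: u'_def[abs_def] set_borel_measurable_def)
  define g where "g s \<omega> = indicator (I_obs lmin T) s * indicator ctrl (s - 1 / lam \<omega>) *
    ennreal ((u' (s - 1 / lam \<omega>) - D s \<omega>)\<^sup>2)" for s \<omega>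
  have "H M lam D lmin T u = (\<integral>\<^sup>+ s. (\<integral>\<^sup>+ \<omega>. g s \<omega> \<partial>M) \<partial>lborel)"
    unfolding H_def
  proof (rule nn_integral_cong)
    fix s :: real
    have "(\<integral>\<^sup>+ \<omega>. ennreal ((u (s - 1 / lam \<omega>) - D s \<omega>)\<^sup>2) \<partial>M) = (\<integral>\<^sup>+ \<omega>. g s \<omega> \<partial>M)"
      if s: "s \<in> I_obs lmin T"
    proof (rule nn_integral_cong_AE)
      show "AE \<omega> in M. ennreal ((u (s - 1 / lam \<omega>) - D s \<omega>)\<^sup>2) = g s \<omega>"
        using lam_bounds
      proof eventually_elim
        case (elim \<omega>)
        \<comment> \<open>The larger bound on the delay keeps the emission time nonnegative, the
          smaller one keeps it below \<open>T - 1 / lmax\<close>.\<close>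
        then have "1 / lmax \<le> 1 / lam \<omega>" "1 / lam \<omega> \<le> 1 / lmin"
          using lmin_pos by (auto intro!: divide_left_mono mult_pos_pos)
        then have "s - 1 / lam \<omega> \<in> ctrl"
          using s by (auto simp: I_obs_def I_ctrl_def)
        then show ?case
          using s by (simp add: g_def u'_def)
      qed
    qed
    then show "(\<integral>\<^sup>+ \<omega>. ennreal ((u (s - 1 / lam \<omega>) - D s \<omega>)\<^sup>2) \<partial>M) * indicator (I_obs lmin T) s
        = (\<integral>\<^sup>+ \<omega>. g s \<omega> \<partial>M)"
      by (cases "s \<in> I_obs lmin T") (auto simp: g_def)
  qed
  also have "\<dots> = (\<integral>\<^sup>+ t. (\<integral>\<^sup>+ \<omega>. g (t + 1 / lam \<omega>) \<omega> \<partial>M) \<partial>lborel)"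
    by (rule nn_integral_shift[OF sf]) (simp_all add: g_def[abs_def])
  also have "\<dots> = (\<integral>\<^sup>+ t\<in>ctrl. (\<integral>\<^sup>+ \<omega>. indicator (A t) \<omega> * ennreal ((u t - X t \<omega>)\<^sup>2) \<partial>M) \<partial>lborel)"
  proof (rule nn_integral_cong)
    fix t :: real
    have "(\<integral>\<^sup>+ \<omega>. g (t + 1 / lam \<omega>) \<omega> \<partial>M)
        = (\<integral>\<^sup>+ \<omega>. indicator (A t) \<omega> * ennreal ((u t - X t \<omega>)\<^sup>2) \<partial>M)" if "t \<in> ctrl"
      using that by (intro nn_integral_cong) (simp add: g_def u'_def indicator_obs_event)
    then show "(\<integral>\<^sup>+ \<omega>. g (t + 1 / lam \<omega>) \<omega> \<partial>M)
        = (\<integral>\<^sup>+ \<omega>. indicator (A t) \<omega> * ennreal ((u t - X t \<omega>)\<^sup>2) \<partial>M) * indicator ctrl t"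
      by (cases "t \<in> ctrl") (auto simp: g_def)
  qed
  finally show ?thesis .
qed

section \<open>The conditional mean of the delayed demand and completing the square\<close>

text \<open>The shift turns the second moment of the demand over the observation window into an
  integral over \<open>t\<close>; as it is finite, so is its integrand for almost every
  \<open>t\<close>.\<close>

lemma AE_delayed_square_integrable:
  "AE t in lborel. set_integrable M (A t) (\<lambda>\<omega>. (X t \<omega>)\<^sup>2)"
proof -
  have sf: "sigma_finite_measure M" ..
  have "(\<integral>\<^sup>+ t. (\<integral>\<^sup>+ \<omega>. indicator (I_obs lmin T) (t + 1 / lam \<omega>) * ennreal ((X t \<omega>)\<^sup>2) \<partial>M) \<partial>lborel)
      = (\<integral>\<^sup>+ s. (\<integral>\<^sup>+ \<omega>. indicator (I_obs lmin T) s * ennreal ((D s \<omega>)\<^sup>2) \<partial>M) \<partial>lborel)"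
    by (rule nn_integral_shift[OF sf, symmetric]) simp_all
  also have "\<dots> = (\<integral>\<^sup>+ s\<in>I_obs lmin T. (\<integral>\<^sup>+ \<omega>. ennreal ((D s \<omega>)\<^sup>2) \<partial>M) \<partial>lborel)"
    by (intro nn_integral_cong) (simp add: nn_integral_cmult mult.commute)
  finally have "AE t in lborel.
      (\<integral>\<^sup>+ \<omega>. indicator (I_obs lmin T) (t + 1 / lam \<omega>) * ennreal ((X t \<omega>)\<^sup>2) \<partial>M) \<noteq> \<infinity>"
    using D_square_finite by (intro nn_integral_PInf_AE) auto
  then show ?thesis
  proof eventually_elim
    case (elim t)
    have "(\<integral>\<^sup>+ \<omega>. ennreal (indicator (A t) \<omega> *\<^sub>R (X t \<omega>)\<^sup>2) \<partial>M)
        = (\<integral>\<^sup>+ \<omega>. indicator (I_obs lmin T) (t + 1 / lam \<omega>) * ennreal ((X t \<omega>)\<^sup>2) \<partial>M)"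
      by (intro nn_integral_cong) (simp add: indicator_obs_event ennreal_mult' ennreal_indicator)
    with elim show ?case
      unfolding set_integrable_def by (intro integrableI_nonneg) (auto simp: less_top)
  qed
qed

text \<open>Decoupling gives the equality for nonnegative integrals, where the demand may be
  averaged at fixed \<open>l\<close> before integrating against \<open>phi\<close>. Finiteness from
  the second moment then returns it to Bochner integrals.\<close>

lemma AE_numerator_eq:
  "AE t in lborel.
    set_integrable lborel (Lam lmin lmax T t) (\<lambda>l. mean_demand M D (t + 1 / l) * phi l) \<and>
    set_integrable M (A t) (X t) \<and>
    (LINT l:Lam lmin lmax T t|lborel. mean_demand M D (t + 1 / l) * phi l) = (LINT \<omega>:A t|M. X t \<omega>)"
  using AE_delayed_square_integrable AE_decouple_delay[OF lam_measurable _ D_measurable I_obs_measurable indep_at, of "\<lambda>l. 1 / l", simplified]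
proof eventually_elim
  case (elim t)
  let ?S = "I_obs lmin T"
  have X_int: "set_integrable M (A t) (X t)"
    by (rule set_square_integrable_imp_set_integrable) (use elim in simp_all)
  have "(\<integral>\<^sup>+ \<omega>. ennreal (indicator (A t) \<omega> *\<^sub>R X t \<omega>) \<partial>M)
      = (\<integral>\<^sup>+ \<omega>. indicator ?S (t + 1 / lam \<omega>) * ennreal (X t \<omega>) \<partial>M)"
    by (intro nn_integral_cong) (simp add: indicator_obs_event ennreal_mult' ennreal_indicator)
  also have "\<dots> = (\<integral>\<^sup>+ l. (\<integral>\<^sup>+ \<omega>. indicator ?S (t + 1 / l) * ennreal (D (t + 1 / l) \<omega>) \<partial>M)
      \<partial>density lborel (\<lambda>l. ennreal (phi l)))"
    using elim(2) unfolding distr_lam .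
  also have "\<dots> = (\<integral>\<^sup>+ l. ennreal (phi l) * (indicator ?S (t + 1 / l) *
      (\<integral>\<^sup>+ \<omega>. ennreal (D (t + 1 / l) \<omega>) \<partial>M)) \<partial>lborel)"
    by (subst nn_integral_density) (auto simp: nn_integral_cmult)
  finally have eq: "(\<integral>\<^sup>+ \<omega>. ennreal (indicator (A t) \<omega> *\<^sub>R X t \<omega>) \<partial>M) = \<dots>" .
  have fin: "(\<integral>\<^sup>+ \<omega>. ennreal (indicator (A t) \<omega> *\<^sub>R X t \<omega>) \<partial>M) < \<infinity>"
    using X_int D_nonneg unfolding set_integrable_def
    by (subst nn_integral_eq_integral) auto
  then have "AE l in lborel. ennreal (phi l) * (indicator ?S (t + 1 / l) *
      (\<integral>\<^sup>+ \<omega>. ennreal (D (t + 1 / l) \<omega>) \<partial>M)) \<noteq> \<infinity>"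
    unfolding eq by (intro nn_integral_PInf_AE) auto
  then have "AE l in lborel. ennreal (phi l) * (indicator ?S (t + 1 / l) *
      (\<integral>\<^sup>+ \<omega>. ennreal (D (t + 1 / l) \<omega>) \<partial>M)) =
      ennreal (indicator (Lam lmin lmax T t) l *\<^sub>R (mean_demand M D (t + 1 / l) * phi l))"
    using AE_phi_support
  proof eventually_elim
    case (elim l)
    show ?case
    proof (cases "phi l = 0 \<or> t + 1 / l \<notin> ?S")
      case True
      then show ?thesis
        using indicator_Lam[OF elim(2), of t] by auto
    next
      case False
      then have "indicator (Lam lmin lmax T t) l = (1 :: real)"
        using indicator_Lam[OF elim(2), of t] by simp
      \<comment> \<open>An infinite mean would make the Bochner integral in
        \<open>mean_demand\<close> zero. Since \<open>phi l\<close> is positive and the integrand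
        finite at this \<open>l\<close>, that cannot happen.\<close>
      moreover have "(\<integral>\<^sup>+ \<omega>. ennreal (D (t + 1 / l) \<omega>) \<partial>M) < \<infinity>"
        using False elim(1) phi_nonneg[of l] by (auto simp: ennreal_mult_eq_top_iff less_top)
      then have "(\<integral>\<^sup>+ \<omega>. ennreal (D (t + 1 / l) \<omega>) \<partial>M) = ennreal (mean_demand M D (t + 1 / l))"
        unfolding mean_demand_def
        by (subst integral_eq_nn_integral) (auto simp: D_nonneg)
      ultimately show ?thesis
        using False by (simp add: ennreal_mult phi_nonneg mean_demand_nonneg mult.commute)
    qed
  qed
  then have eq': "(\<integral>\<^sup>+ \<omega>. ennreal (indicator (A t) \<omega> *\<^sub>R X t \<omega>) \<partial>M) =
      (\<integral>\<^sup>+ l. ennreal (indicator (Lam lmin lmax T t) l *\<^sub>R (mean_demand M D (t + 1 / l) * phi l)) \<partial>lborel)"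
    unfolding eq by (rule nn_integral_cong_AE)
  have "set_integrable lborel (Lam lmin lmax T t) (\<lambda>l. mean_demand M D (t + 1 / l) * phi l)"
    using fin unfolding eq' set_integrable_def
    by (intro integrableI_nonneg) (auto simp: phi_nonneg mean_demand_nonneg)
  moreover have "(LINT l:Lam lmin lmax T t|lborel. mean_demand M D (t + 1 / l) * phi l) = (LINT \<omega>:A t|M. X t \<omega>)"
    unfolding set_lebesgue_integral_def
    by (subst (1 2) integral_eq_nn_integral)
      (auto simp: phi_nonneg mean_demand_nonneg D_nonneg eq'[simplified])
  ultimately show ?case
    using X_int by simp
qed

text \<open>The square deviation split is applied at almost every \<open>t\<close> with centre
  \<open>ustar\<close>, the weight being \<open>q\<close> because it is the probability of the
  event, and then integrated over \<open>t\<close>.\<close>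

lemma H_eq_H_ustar_plus:
  assumes u: "set_borel_measurable lborel ctrl u"
  shows "H M lam D lmin T u = H M lam D lmin T (ustar M D phi lmin lmax T) +
    (\<integral>\<^sup>+ t\<in>ctrl. ennreal (qq t * (u t - us t)\<^sup>2) \<partial>lborel)"
proof -
  define u' where "u' t = indicator ctrl t * u t" for t
  have [measurable]: "u' \<in> borel_measurable borel"
    using u by (simp add: u'_def[abs_def] set_borel_measurable_def)
  have us: "set_borel_measurable lborel ctrl (ustar M D phi lmin lmax T)"
    unfolding set_borel_measurable_def by measurable
  \<comment> \<open>Written with the indicator of a fixed set instead of the event depending on
    \<open>t\<close>, the integrand is visibly jointly measurable.\<close>
  define G where "G t = (\<integral>\<^sup>+ \<omega>. indicator (I_obs lmin T) (t + 1 / lam \<omega>) * ennreal ((us t - X t \<omega>)\<^sup>2) \<partial>M)" for t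
  have [measurable]: "G \<in> borel_measurable borel"
    unfolding G_def[abs_def] by measurable
  have G: "G t = (\<integral>\<^sup>+ \<omega>. indicator (A t) \<omega> * ennreal ((us t - X t \<omega>)\<^sup>2) \<partial>M)" for t
    unfolding G_def by (intro nn_integral_cong) (simp add: indicator_obs_event)
  have "H M lam D lmin T u =
      (\<integral>\<^sup>+ t. G t * indicator ctrl t + ennreal (qq t * (u' t - us t)\<^sup>2) * indicator ctrl t \<partial>lborel)"
    unfolding H_eq_control_integral[OF u]
  proof (rule nn_integral_cong_AE)
    show "AE t in lborel. (\<integral>\<^sup>+ \<omega>. indicator (A t) \<omega> * ennreal ((u t - X t \<omega>)\<^sup>2) \<partial>M) * indicator ctrl t
        = G t * indicator ctrl t + ennreal (qq t * (u' t - us t)\<^sup>2) * indicator ctrl t"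
      using AE_delayed_square_integrable AE_numerator_eq
    proof eventually_elim
      case (elim t)
      \<comment> \<open>On a null event both sides vanish, whatever value \<open>ustar\<close>
        takes.\<close>
      have "prob (A t) * us t = (LINT \<omega>:A t|M. X t \<omega>)"
      proof (cases "prob (A t) = 0")
        case True
        then have "AE \<omega> in M. \<omega> \<notin> A t"
          by (simp add: prob_eq_0)
        then have "(LINT \<omega>:A t|M. X t \<omega>) = 0"
          unfolding set_lebesgue_integral_def by (intro integral_eq_zero_AE) auto
        with True show ?thesis by simp
      next
        case False
        with elim(2) show ?thesis by (simp add: ustar_def q_eq_prob)
      qed
      from set_square_deviation_split[OF _ _ elim(1) this, of "u t"]
      show ?case
        by (auto simp: G q_eq_prob u'_def indicator_def)
    qed
  qed
  also have "\<dots> = (\<integral>\<^sup>+ t\<in>ctrl. G t \<partial>lborel)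
      + (\<integral>\<^sup>+ t\<in>ctrl. ennreal (qq t * (u' t - us t)\<^sup>2) \<partial>lborel)"
    by (rule nn_integral_add) measurable
  also have "(\<integral>\<^sup>+ t\<in>ctrl. G t \<partial>lborel) = H M lam D lmin T (ustar M D phi lmin lmax T)"
    unfolding H_eq_control_integral[OF us] G ..
  also have "(\<integral>\<^sup>+ t\<in>ctrl. ennreal (qq t * (u' t - us t)\<^sup>2) \<partial>lborel)
      = (\<integral>\<^sup>+ t\<in>ctrl. ennreal (qq t * (u t - us t)\<^sup>2) \<partial>lborel)"
    by (intro nn_integral_cong) (simp add: u'_def indicator_def)
  finally show ?thesis .
qed

lemma H_zero_finite: "H M lam D lmin T (\<lambda>_. 0) < \<infinity>"
  using D_square_finite by (simp add: H_def)

lemma AE_ustar_eq_cond_expectation: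
  "AE t in lborel. 0 < qq t \<longrightarrow>
    set_integrable lborel (Lam lmin lmax T t) (\<lambda>l. mean_demand M D (t + 1 / l) * phi l) \<and>
    0 < prob (A t) \<and> set_integrable M (A t) (X t) \<and> us t = cond_expectation M (X t) (A t)"
  using AE_numerator_eq
  by eventually_elim (simp add: ustar_def cond_expectation_def q_eq_prob)

end

text \<open>Optimality is stated as a characterization, with existence of an optimum equivalent to
  square integrability of \<open>ustar\<close>; its objective value is the infimum in any case. The
  integrability claims ensure that no quotient rests on the default value of a Bochner
  integral.\<close>

theorem theorem3p1:
  fixes M :: "'a measure"
    and lam :: "'a \<Rightarrow> real"
    and D :: "real \<Rightarrow> 'a \<Rightarrow> real"
    and phi :: "real \<Rightarrow> real"
    and lmin lmax T :: real
  assumes "prob_space M"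
    and "0 < lmin" and "lmin < lmax" and "1 / lmin < T"
    and "lam \<in> borel_measurable M"
    and "AE \<omega> in M. lmin \<le> lam \<omega> \<and> lam \<omega> \<le> lmax"
    and "C1_on {lmin..lmax} (cdf (distr M borel lam))"
    and "\<And>l. 0 \<le> phi l"
    and "distributed M lborel lam (\<lambda>l. ennreal (phi l))"
    and "\<And>t \<omega>. t \<in> {0..T} \<Longrightarrow> \<omega> \<in> space M \<Longrightarrow> 0 \<le> D t \<omega>"
    and "(\<lambda>(t, \<omega>). D t \<omega>) \<in> borel_measurable (restrict_space borel {0..T} \<Otimes>\<^sub>M M)"
    and "integrable (restrict_space lborel {0<..<T} \<Otimes>\<^sub>M M) (\<lambda>(t, \<omega>). (D t \<omega>)\<^sup>2)"
    and "prob_space.indep_set M (sigma_var M lam) (sigma_process M {0..T} D)"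
  shows
    "(\<forall>u. optimal_control M lam D lmin lmax T u \<longleftrightarrow>
        u \<in> L2_on (I_ctrl lmax T) \<and>
        (AE t \<in> I_ctrl lmax T in lborel.
           0 < q phi lmin lmax T t \<longrightarrow> u t = ustar M D phi lmin lmax T t)) \<and>
     ((\<exists>u. optimal_control M lam D lmin lmax T u) \<longleftrightarrow>
        ustar M D phi lmin lmax T \<in> L2_on (I_ctrl lmax T)) \<and>
     H M lam D lmin T (ustar M D phi lmin lmax T) =
       (INF v \<in> L2_on (I_ctrl lmax T). H M lam D lmin T v) \<and>
     H M lam D lmin T (ustar M D phi lmin lmax T) < \<infinity> \<and>
     (AE t \<in> I_ctrl lmax T in lborel. 0 < q phi lmin lmax T t \<longrightarrow>
        set_integrable lborel (Lam lmin lmax T t) (\<lambda>l. mean_demand M D (t + 1 / l) * phi l) \<and>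
        0 < measure M (obs_event M lam lmin T t) \<and>
        set_integrable M (obs_event M lam lmin T t) (\<lambda>\<omega>. D (t + 1 / lam \<omega>) \<omega>) \<and>
        ustar M D phi lmin lmax T t =
          cond_expectation M (\<lambda>\<omega>. D (t + 1 / lam \<omega>) \<omega>) (obs_event M lam lmin T t))"
proof -
  \<comment> \<open>The demand is controlled only on \<open>{0..T}\<close>, so the locale is
    instantiated with its extension by zero. All quantities in the claim see it at observation times
    only, where the two agree.\<close>
  define Y where "Y s \<omega> = indicator {0..T} s * D s \<omega>" for s \<omega>
  interpret prob_space M by fact
  have obs_sub: "I_obs lmin T \<subseteq> {0..T}"
    using \<open>0 < lmin\<close> by (auto simp: I_obs_def intro: order_trans[of 0 "1 / lmin"])
  have Y_eq: "Y s = D s" if "s \<in> I_obs lmin T" for s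
    using that obs_sub by (auto simp: Y_def[abs_def])
  have fin: "(\<integral>\<^sup>+ s\<in>I_obs lmin T. (\<integral>\<^sup>+ \<omega>. ennreal ((Y s \<omega>)\<^sup>2) \<partial>M) \<partial>lborel) < \<infinity>"
  proof -
    let ?R = "restrict_space lborel {0<..<T}"
    have "(\<integral>\<^sup>+ s\<in>I_obs lmin T. (\<integral>\<^sup>+ \<omega>. ennreal ((Y s \<omega>)\<^sup>2) \<partial>M) \<partial>lborel)
        \<le> (\<integral>\<^sup>+ s\<in>{0<..<T}. (\<integral>\<^sup>+ \<omega>. ennreal ((D s \<omega>)\<^sup>2) \<partial>M) \<partial>lborel)"
    proof (rule nn_integral_mono_AE)
      show "AE s in lborel. (\<integral>\<^sup>+ \<omega>. ennreal ((Y s \<omega>)\<^sup>2) \<partial>M) * indicator (I_obs lmin T) s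
          \<le> (\<integral>\<^sup>+ \<omega>. ennreal ((D s \<omega>)\<^sup>2) \<partial>M) * indicator {0<..<T} s"
        \<comment> \<open>Square integrability is given on the open interval; the endpoints form a
          null set.\<close>
        using AE_lborel_singleton[of 0] AE_lborel_singleton[of T]
      proof eventually_elim
        case (elim s)
        then show ?case
          using obs_sub Y_eq[of s] by (cases "s \<in> I_obs lmin T") (force simp: indicator_def)+
      qed
    qed
    also have "\<dots> = (\<integral>\<^sup>+ s. (\<integral>\<^sup>+ \<omega>. ennreal ((D s \<omega>)\<^sup>2) \<partial>M) \<partial>?R)"
      by (subst nn_integral_restrict_space) auto
    also have "\<dots> = (\<integral>\<^sup>+ z. ennreal (case z of (s, \<omega>) \<Rightarrow> (D s \<omega>)\<^sup>2) \<partial>(?R \<Otimes>\<^sub>M M))"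
      using borel_measurable_integrable[OF assms(12)]
      by (subst nn_integral_fst[symmetric]) auto
    also have "\<dots> < \<infinity>"
      using assms(12) by (subst nn_integral_eq_integral) auto
    finally show ?thesis .
  qed
  interpret outflow_tracking M lam Y phi lmin lmax T
  proof
    show "(\<lambda>(t, \<omega>). Y t \<omega>) \<in> borel_measurable (borel \<Otimes>\<^sub>M M)"
      unfolding Y_def by (rule borel_measurable_zero_extension) (use assms(11) in simp_all)
    show "0 \<le> Y t \<omega>" if "\<omega> \<in> space M" for t \<omega>
      using assms(10) that by (auto simp: Y_def indicator_def)
    show "indep_set (sigma_var M lam) (sigma_var M (Y s))" if s: "s \<in> I_obs lmin T" for s
    proof -
      \<comment> \<open>Independence from the whole process passes to a single time by
        monotonicity.\<close>
      have "sigma_var M (D s) \<subseteq> sigma_process M {0..T} D"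
        using s obs_sub unfolding sigma_process_def by (auto intro!: sigma_sets.Basic)
      then show ?thesis
        unfolding Y_eq[OF s] indep_set_def
        by (intro indep_sets_mono_sets[OF assms(13)[unfolded indep_set_def]])
          (auto split: bool.split)
    qed
  qed (use assms fin in auto)
  have mean_eq: "mean_demand M Y s = mean_demand M D s" if "s \<in> I_obs lmin T" for s
    by (simp add: mean_demand_def Y_eq[OF that])
  have Lam_obs: "t + 1 / l \<in> I_obs lmin T" if "l \<in> Lam lmin lmax T t" for t l
    using that by (simp add: Lam_def I_obs_def)
  have ustar_eq: "ustar M Y phi lmin lmax T = ustar M D phi lmin lmax T"
    unfolding ustar_def[abs_def] set_lebesgue_integral_def
    by (intro ext arg_cong2[where f = "(/)"] Bochner_Integration.integral_cong refl)
      (auto simp: indicator_def mean_eq Lam_obs)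
  have H_eq: "H M lam Y lmin T u = H M lam D lmin T u" for u
    unfolding H_def by (intro nn_integral_cong) (auto simp: indicator_def Y_eq)
  have mean_int: "set_integrable lborel (Lam lmin lmax T t) (\<lambda>l. mean_demand M Y (t + 1 / l) * phi l) \<longleftrightarrow>
      set_integrable lborel (Lam lmin lmax T t) (\<lambda>l. mean_demand M D (t + 1 / l) * phi l)" for t
    unfolding set_integrable_def
    by (intro Bochner_Integration.integrable_cong refl) (auto simp: indicator_def mean_eq Lam_obs)
  have delayed_eq: "indicator (obs_event M lam lmin T t) \<omega> *\<^sub>R Y (t + 1 / lam \<omega>) \<omega> =
      indicator (obs_event M lam lmin T t) \<omega> *\<^sub>R D (t + 1 / lam \<omega>) \<omega>" for t \<omega>
    by (auto simp: indicator_def obs_event_def Y_eq)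
  have r: "set_borel_measurable lborel (I_ctrl lmax T) (ustar M D phi lmin lmax T)"
    using ustar_measurable unfolding ustar_eq set_borel_measurable_def by measurable
  have w: "0 \<le> q phi lmin lmax T t" for t
    by (simp add: q_eq_prob)
  have r_zero: "ustar M D phi lmin lmax T t = 0" if "q phi lmin lmax T t = 0" for t
    using that by (simp add: ustar_def)
  have ctrl: "emeasure lborel (I_ctrl lmax T) < \<infinity>"
    unfolding I_ctrl_def by (cases "0 \<le> T - 1 / lmax") auto
  \<comment> \<open>The abstract minimization is used with weight \<open>q\<close> and centre
    \<open>ustar\<close>, which is zero where \<open>q\<close> vanishes by the convention for
    division.\<close>
  note minimum = I_ctrl_measurable ctrl q_measurable w r r_zero
    H_eq_H_ustar_plus[unfolded H_eq ustar_eq] H_zero_finite[unfolded H_eq]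
  show ?thesis
    unfolding optimal_control_def
    using weighted_L2_minimum_value[OF minimum] weighted_L2_minimum_iff[OF minimum]
      weighted_L2_minimum_exists[OF minimum] weighted_L2_minimum_finite[OF minimum]
      AE_ustar_eq_cond_expectation
    unfolding ustar_eq cond_expectation_def set_lebesgue_integral_def mean_int
      set_integrable_def[of M] delayed_eq
    by (auto elim: eventually_mono)
qed

end
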